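(* Let $n\ge 2$, let $(s_1,\dots,s_{n-1},p)\in\mathbb C^n$, and, when $|p|\neq1$, let \[ Q=\left(\frac{s_1-\overline{s_{n-1}}p}{1-|p|^2},\frac{s_2-\overline{s_{n-2}}p}{1-|p|^2},\dots,\frac{s_{n-1}-\overline{s_1}p}{1-|p|^2}\right)\in\mathbb C^{n-1}, \] and let $R=\left(\frac{n-1}{n}s_1,\frac{n-2}{n}s_2,\dots,\frac1n s_{n-1}\right)$. Then the following are equivalent: 1. $(s_1,\dots,s_{n-1},p)\in\Gamma_n$; 2. $\Gamma_n$ is a complete spectral set for $(s_1,\dots,s_{n-1},p)$ (regarded as a commuting tuple of operators on $\mathbb C$); 3. $(\omega s_1,\omega^2s_2,\dots,\omega^{n-1}s_{n-1},\omega^np)\in\Gamma_n$ for all $\omega\in\mathbb T$; 4. $\Phi_i(\alpha s_1,\dots,\alpha^{n-1}s_{n-1},\alpha^np)\ge0$ for all $\alpha\in\overline{\mathbb D}$, $i=1,\dots,n-1$, and either ($|p|=1$ and $R\in\Gamma_{n-1}$) or ($|p|\ne1$ and $Q\in\Gamma_{n-1}$); 5. $\left|\binom{n}{i}\alpha^np-\alpha^{n-i}s_{n-i}\right|\le\left|\binom{n}{i}-\alpha^is_i\right|$ for all $\alpha\in\overline{\mathbb D}$, $i=1,\dots,n-1$, and either ($|p|=1$ and $R\in\Gamma_{n-1}$) or ($|p|\ne1$ and $Q\in\Gamma_{n-1}$); 6. $|s_i-\overline{s_{n-i}}p|+|s_{n-i}-\overline{s_i}p|\le\binom{n}{i}(1-|p|^2)$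 for $i=1,\dots,n-1$, and either ($|p|=1$ and $R\in\Gamma_{n-1}$) or ($|p|\ne1$ and $Q\in\Gamma_{n-1}$); 7. $|p|\le1$ and there exists $(c_1,\dots,c_{n-1})\in\Gamma_{n-1}$ such that $s_i=c_i+\overline{c_{n-i}}\,p$ for $i=1,\dots,n-1$.
   Context: $\mathbb D$ is the open unit disc and $\mathbb T$ the unit circle in $\mathbb C$. For $m\ge1$, $\pi_m:\mathbb C^m\to\mathbb C^m$ is the symmetrization map $\pi_m(z)=\left(\sum_{i}z_i,\sum_{i<j}z_iz_j,\dots,\prod_i z_i\right)$, and $\Gamma_m=\pi_m(\overline{\mathbb D}^m)$; in particular $\Gamma_1=\overline{\mathbb D}$. For scalars $(s_1,\dots,s_{n-1},p)\in\mathbb C^n$ and $1\le i\le n-1$, \[ \Phi_i(s_1,\dots,s_{n-1},p)=\binom{n}{i}^2(1-|p|^2)+(|s_i|^2-|s_{n-i}|^2)-\binom{n}{i}(s_i-\overline{s_{n-i}}p)-\binom{n}{i}(\overline{s_i}-\overline{p}s_{n-i}). \] A compact set $X\subset\mathbb C^n$ is a complete spectral set for a commuting operator tuple $\underline T$ if $\sigma_T(\underline T)\subseteq X$ ($\sigma_T$ is the Taylor joint spectrum) and, for every $k\ge1$ and every $k\times k$ matrix $F$ of rational functions whose denominators have no zeros in $X$, $\|F(\underline T)\|\le\sup_{\xi\in X}\|F(\xi)\|$. *)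

theory Defs
  imports
    "HOL-Analysis.Analysis"
    "HOL-Library.Poly_Mapping"
    "HOL-Library.Complex_Order"
begin

text \<open>
  Points of the \<open>n\<close>-dimensional complex space are the elements of \<open>{1..n} \<rightarrow>\<^sub>E UNIV\<close>, that is,
  functions \<open>nat \<Rightarrow> complex\<close> that are \<open>undefined\<close> outside \<open>{1..n}\<close>. With the product topology
  on functions this carrier is homeomorphic to \<open>n\<close>-dimensional space, so \<open>compact\<close> has its usual
  meaning on subsets of it.
\<close>

definition cspace :: "nat \<Rightarrow> (nat \<Rightarrow> complex) set" where
  "cspace n = {1..n} \<rightarrow>\<^sub>E UNIV"

definition tuple :: "nat \<Rightarrow> (nat \<Rightarrow> complex) \<Rightarrow> complex \<Rightarrow> nat \<Rightarrow> complex" where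
  "tuple n s p = (restrict s {1..n - 1})(n := p)"

definition symmetrization :: "nat \<Rightarrow> (nat \<Rightarrow> complex) \<Rightarrow> nat \<Rightarrow> complex" where
  "symmetrization m z = (\<lambda>i\<in>{1..m}. \<Sum>S | S \<subseteq> {1..m} \<and> card S = i. \<Prod>j\<in>S. z j)"

definition Gamma_poly :: "nat \<Rightarrow> (nat \<Rightarrow> complex) set" where
  "Gamma_poly m = symmetrization m ` ({1..m} \<rightarrow>\<^sub>E cball 0 1)"

text \<open>
  The value is a complex number that happens to be real; nonnegativity in the order of
  \<open>HOL-Library.Complex_Order\<close> means real and nonnegative.
\<close>

definition Phi :: "nat \<Rightarrow> nat \<Rightarrow> (nat \<Rightarrow> complex) \<Rightarrow> complex \<Rightarrow> complex" where
  "Phi n i s p =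
     (of_nat (n choose i))\<^sup>2 * of_real (1 - (cmod p)\<^sup>2)
     + of_real ((cmod (s i))\<^sup>2 - (cmod (s (n - i)))\<^sup>2)
     - of_nat (n choose i) * (s i - cnj (s (n - i)) * p)
     - of_nat (n choose i) * (cnj (s i) - cnj p * s (n - i))"


text \<open>
  A complex Hilbert space is given here as a complete real inner product space with a complex
  scalar multiplication that extends the real one and for which the norm is homogeneous. The
  complex inner product is recovered from the norm by polarization.
\<close>

class complex_hilbert = real_inner + complete_space +
  fixes scaleC :: "complex \<Rightarrow> 'a \<Rightarrow> 'a" (infixr "*\<^sub>C" 75)
  assumes scaleC_add_right: "a *\<^sub>C (x + y) = a *\<^sub>C x + a *\<^sub>C y"
    and scaleC_add_left: "(a + b) *\<^sub>C x = a *\<^sub>C x + b *\<^sub>C x"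
    and scaleC_scaleC: "a *\<^sub>C (b *\<^sub>C x) = (a * b) *\<^sub>C x"
    and scaleC_of_real: "of_real r *\<^sub>C x = r *\<^sub>R x"
    and norm_scaleC: "norm (a *\<^sub>C x) = cmod a * norm x"

instantiation complex :: complex_hilbert
begin

definition scaleC_complex :: "complex \<Rightarrow> complex \<Rightarrow> complex" where
  "scaleC_complex a x = a * x"

instance
  by standard (simp_all add: scaleC_complex_def algebra_simps norm_mult scaleR_conv_of_real)

end

definition bounded_clinear :: "('h::complex_hilbert \<Rightarrow> 'h) \<Rightarrow> bool" where
  "bounded_clinear T \<longleftrightarrow> bounded_linear T \<and> (\<forall>c x. T (c *\<^sub>C x) = c *\<^sub>C T x)"

definition commuting_tuple :: "nat \<Rightarrow> (nat \<Rightarrow> 'h::complex_hilbert \<Rightarrow> 'h) \<Rightarrow> bool" where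
  "commuting_tuple n T \<longleftrightarrow>
     (\<forall>i\<in>{1..n}. bounded_clinear (T i)) \<and>
     (\<forall>i\<in>{1..n}. \<forall>j\<in>{1..n}. T i \<circ> T j = T j \<circ> T i)"


text \<open>
  The Koszul complex of \<open>T\<close>. An element of the tensor product of the space with the exterior
  algebra on \<open>e\<^sub>1, \<dots>, e\<^sub>n\<close> is given by its coefficients \<open>f S\<close> at the basis vectors
  \<open>e\<^sub>S\<close> with \<open>S \<subseteq> {1..n}\<close>; those of degree \<open>k\<close> are supported on the sets
  of size \<open>k\<close>. The differential sends \<open>x e\<^sub>S\<close> to the sum over \<open>j\<close> of
  \<open>T\<^sub>j x\<close> times \<open>e\<^sub>j \<and> e\<^sub>S\<close>, which gives the sign below.
\<close>

definition koszul_diff ::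
    "nat \<Rightarrow> (nat \<Rightarrow> 'h::complex_hilbert \<Rightarrow> 'h) \<Rightarrow> (nat set \<Rightarrow> 'h) \<Rightarrow> nat set \<Rightarrow> 'h" where
  "koszul_diff n T f S =
     (if S \<subseteq> {1..n} then \<Sum>j\<in>S. (-1) ^ card {i\<in>S. i < j} *\<^sub>R T j (f (S - {j})) else 0)"

text \<open>
  Exactness in degrees \<open>0, \<dots>, n\<close>. For \<open>k = 0\<close> the only admissible \<open>g\<close> is zero, so the
  condition says that the first differential is injective.
\<close>

definition koszul_exact :: "nat \<Rightarrow> (nat \<Rightarrow> 'h::complex_hilbert \<Rightarrow> 'h) \<Rightarrow> bool" where
  "koszul_exact n T \<longleftrightarrow>
     (\<forall>k\<le>n. \<forall>f.
        (\<forall>S. f S \<noteq> 0 \<longrightarrow> S \<subseteq> {1..n} \<and> card S = k) \<and> (\<forall>S. koszul_diff n T f S = 0) \<longrightarrow>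
        (\<exists>g. (\<forall>S. g S \<noteq> 0 \<longrightarrow> S \<subseteq> {1..n} \<and> Suc (card S) = k) \<and> koszul_diff n T g = f))"

definition taylor_spectrum ::
    "nat \<Rightarrow> (nat \<Rightarrow> 'h::complex_hilbert \<Rightarrow> 'h) \<Rightarrow> (nat \<Rightarrow> complex) set" where
  "taylor_spectrum n T =
     {z \<in> cspace n. \<not> koszul_exact n (\<lambda>i x. T i x - z i *\<^sub>C x)}"


text \<open>
  Polynomials are finitely supported maps from monomials (exponent vectors) to coefficients.
\<close>

type_synonym mpolynomial = "(nat \<Rightarrow>\<^sub>0 nat) \<Rightarrow>\<^sub>0 complex"

definition polys_in :: "nat \<Rightarrow> mpolynomial set" where
  "polys_in n = {P. \<forall>m\<in>Poly_Mapping.keys P. Poly_Mapping.keys m \<subseteq> {1..n}}"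

definition poly_eval :: "nat \<Rightarrow> mpolynomial \<Rightarrow> (nat \<Rightarrow> complex) \<Rightarrow> complex" where
  "poly_eval n P \<xi> =
     (\<Sum>m\<in>Poly_Mapping.keys P.
        Poly_Mapping.lookup P m * (\<Prod>i\<in>{1..n}. \<xi> i ^ Poly_Mapping.lookup m i))"

definition poly_op ::
    "nat \<Rightarrow> mpolynomial \<Rightarrow> (nat \<Rightarrow> 'h::complex_hilbert \<Rightarrow> 'h) \<Rightarrow> 'h \<Rightarrow> 'h" where
  "poly_op n P T x =
     (\<Sum>m\<in>Poly_Mapping.keys P.
        Poly_Mapping.lookup P m *\<^sub>C
          foldr (\<lambda>i g. (T i ^^ Poly_Mapping.lookup m i) \<circ> g) [1..<Suc n] id x)"

text \<open>
  A rational function is given as a pair of numerator and denominator. If the denominator has no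
  zeros on a set containing the Taylor spectrum, then its value at the operator tuple is
  invertible by the spectral mapping theorem, so \<open>inv\<close> below is the genuine inverse operator.
\<close>

definition rat_eval :: "nat \<Rightarrow> mpolynomial \<times> mpolynomial \<Rightarrow> (nat \<Rightarrow> complex) \<Rightarrow> complex" where
  "rat_eval n F \<xi> = poly_eval n (fst F) \<xi> / poly_eval n (snd F) \<xi>"

definition rat_op ::
    "nat \<Rightarrow> mpolynomial \<times> mpolynomial \<Rightarrow> (nat \<Rightarrow> 'h::complex_hilbert \<Rightarrow> 'h) \<Rightarrow> 'h \<Rightarrow> 'h" where
  "rat_op n F T = poly_op n (fst F) T \<circ> inv (poly_op n (snd F) T)"

definition rat_on :: "nat \<Rightarrow> (nat \<Rightarrow> complex) set \<Rightarrow> (mpolynomial \<times> mpolynomial) set" where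
  "rat_on n X =
     {F. fst F \<in> polys_in n \<and> snd F \<in> polys_in n \<and> (\<forall>\<xi>\<in>X. poly_eval n (snd F) \<xi> \<noteq> 0)}"

text \<open>
  The operator norm of a \<open>k \<times> k\<close> operator matrix acting on the \<open>k\<close>-fold Hilbert space
  direct sum.
\<close>

definition matrix_opnorm :: "nat \<Rightarrow> (nat \<Rightarrow> nat \<Rightarrow> 'h::complex_hilbert \<Rightarrow> 'h) \<Rightarrow> real" where
  "matrix_opnorm k A =
     (SUP x\<in>{x. L2_set (\<lambda>j. norm (x j)) {..<k} \<le> 1}.
        L2_set (\<lambda>i. norm (\<Sum>j<k. A i j (x j))) {..<k})"

definition complete_spectral_set ::
    "nat \<Rightarrow> (nat \<Rightarrow> complex) set \<Rightarrow> (nat \<Rightarrow> 'h::complex_hilbert \<Rightarrow> 'h) \<Rightarrow> bool" where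
  "complete_spectral_set n X T \<longleftrightarrow>
     X \<subseteq> cspace n \<and> compact X \<and> commuting_tuple n T \<and>
     taylor_spectrum n T \<subseteq> X \<and>
     (\<forall>k\<ge>1. \<forall>F. (\<forall>i<k. \<forall>j<k. F i j \<in> rat_on n X) \<longrightarrow>
        ereal (matrix_opnorm k (\<lambda>i j. rat_op n (F i j) T))
          \<le> (SUP \<xi>\<in>X. ereal (matrix_opnorm k (\<lambda>i j (z::complex). rat_eval n (F i j) \<xi> * z))))"

definition scalar_ops :: "(nat \<Rightarrow> complex) \<Rightarrow> nat \<Rightarrow> complex \<Rightarrow> complex" where
  "scalar_ops x i = (\<lambda>z. x i * z)"

end

theory Submission
  imports Defs "HOL-Computational_Algebra.Fundamental_Theorem_Algebra"
begin

text \<open>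
  Write \<open>P\<close> for the monic polynomial with coefficients \<open>(-1) ^ i * s i\<close> and constant term
  \<open>(-1) ^ n * p\<close>, so that the point lies in the symmetrized polydisc iff the zeros of \<open>P\<close> lie in
  the closed disc. With \<open>C\<close> the polynomial of \<open>c\<close> and \<open>C* (z) = z ^ (n - 1) * cnj (C (1 / cnj z))\<close>,
  the relations \<open>s i = c i + cnj (c (n - i)) * p\<close> say \<open>P = z * C + (-1) ^ n * p * C*\<close>, and since
  \<open>\<bar>C*\<bar> \<le> \<bar>C\<bar>\<close> outside the disc when \<open>C\<close> has its zeros inside, such a \<open>P\<close> has its zeros inside as well.
  Conversely \<open>c = Q\<close> solves these relations if \<open>\<bar>p\<bar> \<noteq> 1\<close>; if \<open>\<bar>p\<bar> = 1\<close> then \<open>P\<close> is self-inversive,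
  \<open>c = R\<close> solves them, and \<open>n * C\<close> is the derivative of \<open>P\<close>, to which Gauss--Lucas applies.

  Given such a \<open>c\<close>, the inequalities of the fifth condition at \<open>\<alpha> = 1\<close> follow from
  \<open>\<bar>c i\<bar> \<le> (n - 1 choose i)\<close> and Pascal's rule, and for other \<open>\<alpha>\<close> by scaling the zeros. Choosing \<open>\<alpha>\<close> on
  the circle so that the cross term is extremal, and adding the inequalities for \<open>i\<close> and \<open>n - i\<close>,
  gives the sixth condition, which forces \<open>\<bar>p\<bar> \<le> 1\<close> and self-inversiveness if \<open>\<bar>p\<bar> = 1\<close>.

  For scalars the Taylor spectrum is the point itself, because the Koszul complex of a nonzero
  scalar tuple is contractible; this gives the condition on complete spectral sets.
\<close>

section \<open>Symmetrized polydiscs and monic polynomials\<close>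

text \<open>Points carry the coordinates 1 to \<open>m\<close> only, so index 0 supplies the leading
  coefficient by a default value. The alternating sign makes the coordinates the elementary
  symmetric functions of the zeros.\<close>

definition monic_poly :: "nat \<Rightarrow> (nat \<Rightarrow> complex) \<Rightarrow> complex poly" where
  "monic_poly m x = (\<Sum>i\<le>m. monom ((-1) ^ i * (if i = 0 then 1 else x i)) (m - i))"

lemma poly_monic_poly:
  "poly (monic_poly m x) z = (\<Sum>i\<le>m. (-1) ^ i * (if i = 0 then 1 else x i) * z ^ (m - i))"
  by (simp add: monic_poly_def poly_sum poly_monom)

lemma coeff_monic_poly:
  assumes "i \<le> m"
  shows "coeff (monic_poly m x) (m - i) = (-1) ^ i * (if i = 0 then 1 else x i)"
proof -
  have "coeff (monic_poly m x) (m - i)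
      = (\<Sum>k\<le>m. if k = i then (-1) ^ k * (if k = 0 then 1 else x k) else 0)"
    unfolding monic_poly_def coeff_sum using assms by (intro sum.cong) auto
  then show ?thesis using assms by simp
qed

lemma degree_monic_poly: "degree (monic_poly m x) = m"
proof (rule antisym)
  show "degree (monic_poly m x) \<le> m"
    unfolding monic_poly_def by (rule degree_sum_le) (auto intro: order_trans[OF degree_monom_le])
  show "m \<le> degree (monic_poly m x)"
    using coeff_monic_poly[of 0 m x] by (intro le_degree) simp
qed

text \<open>Vieta's formulas: expand the product over subsets and group these by
  cardinality.\<close>

lemma poly_monic_poly_symmetrization:
  "poly (monic_poly m (symmetrization m w)) z = (\<Prod>j\<in>{1..m}. z - w j)"
proof -
  have "(\<Prod>j\<in>{1..m}. z - w j)
      = (\<Sum>S\<in>Pow {1..m}. (-1) ^ card S * (\<Prod>j\<in>S. w j) * z ^ (m - card S))"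
    using finite_subset[OF _ finite_atLeastAtMost[of 1 m]]
    by (simp add: prod_diff_conv_sum card_Diff_subset)
  also have "\<dots> = (\<Sum>i\<le>m. \<Sum>S\<in>{S \<in> Pow {1..m}. card S = i}.
        (-1) ^ card S * (\<Prod>j\<in>S. w j) * z ^ (m - card S))"
  proof (rule sum.group[symmetric])
    show "card ` Pow {1..m} \<subseteq> {..m}"
      using card_mono[of "{1..m}"] by fastforce
  qed auto
  also have "\<dots> = (\<Sum>i\<le>m. (-1) ^ i * (\<Sum>S | S \<subseteq> {1..m} \<and> card S = i. \<Prod>j\<in>S. w j) * z ^ (m - i))"
    by (intro sum.cong) (auto simp: sum_distrib_left sum_distrib_right)
  also have "\<dots> = (\<Sum>i\<le>m. (-1) ^ i * (if i = 0 then 1 else symmetrization m w i) * z ^ (m - i))"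
  proof (intro sum.cong refl)
    fix i assume i: "i \<in> {..m}"
    \<comment> \<open>Index 0 is outside the range of \<open>symmetrization\<close>; there the only
      subset is empty, and its product 1 is the leading coefficient.\<close>
    have "{S. S \<subseteq> {1..m} \<and> card S = 0} = {{}}"
      using finite_subset by fastforce
    then show "(-1) ^ i * (\<Sum>S | S \<subseteq> {1..m} \<and> card S = i. \<Prod>j\<in>S. w j) * z ^ (m - i)
        = (-1) ^ i * (if i = 0 then 1 else symmetrization m w i) * z ^ (m - i)"
      using i by (auto simp: symmetrization_def)
  qed
  finally show ?thesis by (simp add: poly_monic_poly)
qed

text \<open>Fundamental theorem of algebra: the zeros of \<open>monic_poly m x\<close>, with
  multiplicity, form a preimage, and comparing coefficients recovers \<open>x\<close>.\<close>

lemma symmetrization_surj: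
  assumes x: "x \<in> cspace m"
  obtains w where "w \<in> {1..m} \<rightarrow>\<^sub>E UNIV" "symmetrization m w = x"
proof -
  let ?P = "monic_poly m x"
  obtain r where "smult (lead_coeff ?P) (\<Prod>i<degree ?P. [:- r i, 1:]) = ?P"
    using complex_poly_decompose' by blast
  then have r: "(\<Prod>i<m. [:- r i, 1:]) = ?P"
    using coeff_monic_poly[of 0 m x] by (simp add: degree_monic_poly)
  \<comment> \<open>The factorization numbers the zeros from 0, points number their coordinates from
    1.\<close>
  define w where "w = (\<lambda>j\<in>{1..m}. r (j - 1))"
  have "poly ?P z = poly (monic_poly m (symmetrization m w)) z" for z
  proof -
    have "poly ?P z = (\<Prod>i<m. z - r i)"
      by (subst r[symmetric]) (simp add: poly_prod)
    also have "\<dots> = (\<Prod>j\<in>{1..m}. z - w j)"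
      by (rule prod.reindex_bij_witness[of _ "\<lambda>j. j - 1" Suc]) (auto simp: w_def)
    finally show ?thesis by (simp only: poly_monic_poly_symmetrization)
  qed
  then have eq: "?P = monic_poly m (symmetrization m w)"
    by (simp add: poly_eq_poly_eq_iff[symmetric] fun_eq_iff)
  have "symmetrization m w = x"
  proof
    fix i
    show "symmetrization m w i = x i"
    proof (cases "i \<in> {1..m}")
      case True
      have "coeff ?P (m - i) = coeff (monic_poly m (symmetrization m w)) (m - i)"
        using eq by (rule arg_cong)
      then show ?thesis using True by (simp add: coeff_monic_poly)
    next
      case False
      then show ?thesis
        using x PiE_arb[of x "{1..m}" _ i] unfolding symmetrization_def cspace_def restrict_def by auto
    qed
  qed
  then show ?thesis by (intro that[of w]) (auto simp: w_def)
qed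

lemma Gamma_poly_roots:
  assumes "x \<in> Gamma_poly m"
  shows "\<exists>w. (\<forall>j\<in>{1..m}. cmod (w j) \<le> 1) \<and> x = symmetrization m w \<and>
    (\<forall>z. poly (monic_poly m x) z = (\<Prod>j\<in>{1..m}. z - w j))"
proof -
  obtain w where w: "x = symmetrization m w" "w \<in> {1..m} \<rightarrow>\<^sub>E cball 0 1"
    using assms unfolding Gamma_poly_def by (rule imageE)
  have "\<forall>j\<in>{1..m}. cmod (w j) \<le> 1"
    using PiE_mem[OF w(2)] by simp
  then show ?thesis unfolding w(1) using poly_monic_poly_symmetrization by (intro exI[of _ w]) simp
qed

text \<open>The zeros do not depend on the choice of a preimage, so membership can be proved or
  refuted one zero at a time.\<close>

lemma Gamma_poly_iff:
  "x \<in> Gamma_poly m \<longleftrightarrow> x \<in> cspace m \<and> (\<forall>z. poly (monic_poly m x) z = 0 \<longrightarrow> cmod z \<le> 1)"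
proof (intro iffI conjI allI impI)
  assume x: "x \<in> Gamma_poly m"
  then show "x \<in> cspace m"
    unfolding Gamma_poly_def by (rule imageE) (simp add: symmetrization_def cspace_def)
  fix z assume "poly (monic_poly m x) z = 0"
  then show "cmod z \<le> 1"
    using Gamma_poly_roots[OF x] by auto
next
  assume *: "x \<in> cspace m \<and> (\<forall>z. poly (monic_poly m x) z = 0 \<longrightarrow> cmod z \<le> 1)"
  then obtain w where w: "w \<in> {1..m} \<rightarrow>\<^sub>E UNIV" "symmetrization m w = x"
    using symmetrization_surj by blast
  have "cmod (w j) \<le> 1" if "j \<in> {1..m}" for j
  proof -
    have "poly (monic_poly m x) (w j) = 0"
      unfolding w(2)[symmetric] poly_monic_poly_symmetrization using that by auto
    then show ?thesis using * by blast
  qed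
  then have "w \<in> {1..m} \<rightarrow>\<^sub>E cball 0 1"
    using w(1) by (simp add: PiE_iff)
  then have "symmetrization m w \<in> Gamma_poly m"
    unfolding Gamma_poly_def by (rule imageI)
  then show "x \<in> Gamma_poly m" by (simp only: w(2))
qed

text \<open>Each coordinate is a sum of \<open>m choose i\<close> products of modulus at most
  1.\<close>

lemma Gamma_poly_coord_bound:
  assumes "x \<in> Gamma_poly m" "i \<in> {1..m}"
  shows "cmod (x i) \<le> real (m choose i)"
proof -
  obtain w where w: "\<forall>j\<in>{1..m}. cmod (w j) \<le> 1" "x = symmetrization m w"
    "\<forall>z. poly (monic_poly m x) z = (\<Prod>j\<in>{1..m}. z - w j)"
    using Gamma_poly_roots[OF assms(1)] by blast
  have "cmod (x i) \<le> (\<Sum>S | S \<subseteq> {1..m} \<and> card S = i. cmod (\<Prod>j\<in>S. w j))"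
    using assms(2) by (simp add: w(2) symmetrization_def norm_sum)
  also have "\<dots> \<le> (\<Sum>S | S \<subseteq> {1..m} \<and> card S = i. 1)"
  proof (rule sum_mono)
    fix S assume "S \<in> {S. S \<subseteq> {1..m} \<and> card S = i}"
    then show "cmod (\<Prod>j\<in>S. w j) \<le> 1"
      unfolding prod_norm[symmetric] using w(1) by (intro prod_le_1) auto
  qed
  also have "\<dots> = real (m choose i)"
    using n_subsets[of "{1..m}" i] by simp
  finally show ?thesis .
qed

section \<open>Reflection in the unit circle\<close>

text \<open>The squared moduli differ by \<open>((cmod z)^2 - 1) * (1 - (cmod w)^2)\<close>.\<close>

lemma cmod_reflect_le:
  assumes "cmod w \<le> 1" "cmod z \<ge> 1"
  shows "cmod (1 - z * cnj w) \<le> cmod (z - w)"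
proof -
  have "complex_of_real ((cmod (z - w))\<^sup>2 - (cmod (1 - z * cnj w))\<^sup>2)
      = complex_of_real (((cmod z)\<^sup>2 - 1) * (1 - (cmod w)\<^sup>2))"
    unfolding of_real_diff of_real_mult complex_norm_square by (simp add: algebra_simps complex_norm_square)
  then have "(cmod (z - w))\<^sup>2 - (cmod (1 - z * cnj w))\<^sup>2 = ((cmod z)\<^sup>2 - 1) * (1 - (cmod w)\<^sup>2)"
    using of_real_eq_iff by blast
  moreover have "((cmod z)\<^sup>2 - 1) * (1 - (cmod w)\<^sup>2) \<ge> 0"
    using assms by (intro mult_nonneg_nonneg) (auto simp: power_le_one)
  ultimately have "(cmod (1 - z * cnj w))\<^sup>2 \<le> (cmod (z - w))\<^sup>2" by linarith
  then show ?thesis by (rule power2_le_imp_le) simp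
qed

text \<open>The left side is the modulus of the reversed polynomial, whose factors are
  \<open>1 - z * cnj (w j)\<close>; \<open>cmod_reflect_le\<close> compares factor by
  factor.\<close>

lemma Gamma_poly_reflect_le:
  assumes "x \<in> Gamma_poly m" "cmod z \<ge> 1"
  shows "cmod (z ^ m * cnj (poly (monic_poly m x) (1 / cnj z))) \<le> cmod (poly (monic_poly m x) z)"
proof -
  obtain w where w: "\<forall>j\<in>{1..m}. cmod (w j) \<le> 1" "x = symmetrization m w"
    "\<forall>z. poly (monic_poly m x) z = (\<Prod>j\<in>{1..m}. z - w j)"
    using Gamma_poly_roots[OF assms(1)] by blast
  have z: "z \<noteq> 0" using assms(2) by auto
  have "z ^ m = (\<Prod>j\<in>{1..m}. z)" by simp
  then have "z ^ m * cnj (poly (monic_poly m x) (1 / cnj z)) = (\<Prod>j\<in>{1..m}. 1 - z * cnj (w j))"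
    using z unfolding w(3)[rule_format] cnj_prod by (simp only: prod.distrib[symmetric]) (simp add: algebra_simps)
  moreover have "(\<Prod>j\<in>{1..m}. cmod (1 - z * cnj (w j))) \<le> (\<Prod>j\<in>{1..m}. cmod (z - w j))"
    using w(1) assms(2) by (intro prod_mono) (auto intro: cmod_reflect_le)
  ultimately show ?thesis by (simp add: w(3) prod_norm)
qed

section \<open>Decomposition through a point of one dimension less\<close>

lemma tuple_simps:
  assumes "n \<ge> 1"
  shows "i \<in> {1..n - 1} \<Longrightarrow> tuple n s p i = s i" "tuple n s p n = p" "tuple n s p \<in> cspace n"
  using assms by (auto simp: tuple_def cspace_def PiE_iff extensional_def)

text \<open>The first summand collects the leading term and the \<open>c i\<close>; the second
  collects the conjugate terms and, through the constant term 1 of the reversed polynomial, the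
  constant term. A nonzero \<open>z\<close> lets the reversal be written pointwise with
  \<open>1 / cnj z\<close>.\<close>

lemma poly_monic_poly_tuple:
  assumes n: "n \<ge> 1" and z: "z \<noteq> 0"
    and s: "\<And>i. i \<in> {1..n - 1} \<Longrightarrow> s i = c i + cnj (c (n - i)) * p"
  shows "poly (monic_poly n (tuple n s p)) z = z * poly (monic_poly (n - 1) c) z
    + (-1) ^ n * p * (z ^ (n - 1) * cnj (poly (monic_poly (n - 1) c) (1 / cnj z)))"
proof -
  let ?a = "\<lambda>i. if i = 0 then 1 else c i"
  obtain m where m: "n = Suc m" using n by (cases n) auto
  have split0: "(\<Sum>i\<le>m. f i) = f 0 + (\<Sum>i=1..m. f i)" for f :: "nat \<Rightarrow> complex"
    by (simp add: atMost_atLeast0 sum.atLeast_Suc_atMost)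
  have 1: "poly (monic_poly n (tuple n s p)) z
      = z ^ n + (\<Sum>i=1..m. (-1) ^ i * s i * z ^ (n - i)) + (-1) ^ n * p"
  proof -
    have "(\<Sum>i=1..m. (-1) ^ i * (if i = 0 then 1 else tuple n s p i) * z ^ (n - i))
        = (\<Sum>i=1..m. (-1) ^ i * s i * z ^ (n - i))"
      using tuple_simps(1)[OF n, of _ s p] m by (intro sum.cong) auto
    then show ?thesis
      using tuple_simps(2)[OF n, of s p] unfolding poly_monic_poly
      by (simp add: m split0)
  qed
  have 2: "z * poly (monic_poly m c) z = z ^ n + (\<Sum>i=1..m. (-1) ^ i * c i * z ^ (n - i))"
    unfolding poly_monic_poly split0 sum_distrib_left distrib_left m
    by (auto intro!: sum.cong simp: Suc_diff_le)
  have 3: "z ^ m * cnj (poly (monic_poly m c) (1 / cnj z))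
      = 1 + (\<Sum>i=1..m. (-1) ^ i * cnj (c i) * z ^ i)"
  proof -
    have "z ^ m * cnj (poly (monic_poly m c) (1 / cnj z))
        = (\<Sum>i\<le>m. (-1) ^ i * cnj (?a i) * (z ^ m * (1 / z) ^ (m - i)))"
      unfolding poly_monic_poly cnj_sum sum_distrib_left by (intro sum.cong) auto
    also have "\<dots> = (\<Sum>i\<le>m. (-1) ^ i * cnj (?a i) * z ^ i)"
      using z by (intro sum.cong) (auto simp: power_diff power_one_over field_simps)
    finally show ?thesis by (simp add: split0)
  qed
  \<comment> \<open>Substituting \<open>n - i\<close> for \<open>i\<close> matches the powers of
    \<open>z\<close>, and the signs agree because \<open>n + i\<close> and \<open>n - i\<close> have
    the same parity.\<close>
  have 4: "(-1) ^ n * p * (\<Sum>i=1..m. (-1) ^ i * cnj (c i) * z ^ i)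
      = (\<Sum>i=1..m. (-1) ^ i * (cnj (c (n - i)) * p) * z ^ (n - i))"
    unfolding sum_distrib_left
  proof (rule sum.reindex_bij_witness[of _ "\<lambda>i. n - i" "\<lambda>i. n - i"])
    fix i assume i: "i \<in> {1..m}"
    have "(-1 :: complex) ^ n * (-1) ^ i = (-1) ^ (n - i)"
      using i m by (simp flip: power_add add: minus_one_power_iff)
    then show "(-1) ^ (n - i) * (cnj (c (n - (n - i))) * p) * z ^ (n - (n - i))
        = (-1) ^ n * p * ((-1) ^ i * cnj (c i) * z ^ i)"
      using i m by (simp del: power_Suc add: mult_ac)
  qed (auto simp: m)
  have 5: "(\<Sum>i=1..m. (-1) ^ i * s i * z ^ (n - i))
      = (\<Sum>i=1..m. (-1) ^ i * c i * z ^ (n - i))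
        + (\<Sum>i=1..m. (-1) ^ i * (cnj (c (n - i)) * p) * z ^ (n - i))"
    unfolding sum.distrib[symmetric] using s m by (intro sum.cong) (auto simp: algebra_simps)
  have "n - 1 = m" using m by simp
  then show ?thesis
    unfolding \<open>n - 1 = m\<close> 1 2 3 5 4[symmetric] by (simp add: algebra_simps)
qed

text \<open>At a zero \<open>z\<close> outside the disc the two summands of
  \<open>poly_monic_poly_tuple\<close> would have equal modulus. The reflected one is at most
  |C(z)|, the other is |z| |C(z)|, which is larger since C has no zero there.\<close>

lemma tuple_in_Gamma_polyI:
  assumes n: "n \<ge> 1" and p: "cmod p \<le> 1" and c: "c \<in> Gamma_poly (n - 1)"
    and s: "\<And>i. i \<in> {1..n - 1} \<Longrightarrow> s i = c i + cnj (c (n - i)) * p"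
  shows "tuple n s p \<in> Gamma_poly n"
  unfolding Gamma_poly_iff
proof (intro conjI allI impI)
  show "tuple n s p \<in> cspace n" using n by (rule tuple_simps)
  fix z assume zero: "poly (monic_poly n (tuple n s p)) z = 0"
  show "cmod z \<le> 1"
  proof (rule ccontr)
    assume "\<not> cmod z \<le> 1"
    then have z: "cmod z > 1" by simp
    let ?C = "poly (monic_poly (n - 1) c) z"
    let ?D = "z ^ (n - 1) * cnj (poly (monic_poly (n - 1) c) (1 / cnj z))"
    have z0: "z \<noteq> 0" using z by auto
    have "z * ?C + (-1) ^ n * p * ?D = 0"
      using poly_monic_poly_tuple[where s = s and c = c and p = p, OF n z0] s zero by metis
    then have "z * ?C = - ((-1) ^ n * p * ?D)"
      by (simp only: eq_neg_iff_add_eq_0)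
    then have "cmod (z * ?C) = cmod (- ((-1) ^ n * p * ?D))"
      by (rule arg_cong)
    then have "cmod z * cmod ?C = cmod p * cmod ?D"
      by (simp add: norm_mult norm_power mult.assoc)
    also have "\<dots> \<le> 1 * cmod ?C"
      using Gamma_poly_reflect_le[OF c, of z] p z by (intro mult_mono) auto
    finally have "cmod ?C = 0" using z
      using mult_strict_right_mono[of 1 "cmod z" "cmod ?C"] by fastforce
    then show False using c z by (auto simp: Gamma_poly_iff)
  qed
qed

text \<open>At a zero \<open>z\<close> of C outside the disc, P(z) = (-1)^n p C*(z), while the
  reversed polynomial of P takes the value C*(z). The reflection bound for P gives |C*(z)| \<le> |p|
  |C*(z)|, so P(z) = 0, contradicting the location of its zeros.\<close>

lemma reflection_solution_in_Gamma_poly: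
  assumes n: "n \<ge> 1" and p: "cmod p < 1" and c: "c \<in> cspace (n - 1)"
    and x: "tuple n s p \<in> Gamma_poly n"
    and s: "\<And>i. i \<in> {1..n - 1} \<Longrightarrow> s i = c i + cnj (c (n - i)) * p"
  shows "c \<in> Gamma_poly (n - 1)"
  unfolding Gamma_poly_iff
proof (intro conjI allI impI)
  show "c \<in> cspace (n - 1)" by (rule c)
  fix z assume zero: "poly (monic_poly (n - 1) c) z = 0"
  show "cmod z \<le> 1"
  proof (rule ccontr)
    assume "\<not> cmod z \<le> 1"
    then have z: "cmod z > 1" by simp
    then have z0: "z \<noteq> 0" by auto
    let ?P = "poly (monic_poly n (tuple n s p))"
    let ?D = "z ^ (n - 1) * cnj (poly (monic_poly (n - 1) c) (1 / cnj z))"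
    have shift: "?P y = y * poly (monic_poly (n - 1) c) y
        + (-1) ^ n * p * (y ^ (n - 1) * cnj (poly (monic_poly (n - 1) c) (1 / cnj y)))"
      if "y \<noteq> 0" for y
      using n that s by (rule poly_monic_poly_tuple)
    have P: "?P z = (-1) ^ n * p * ?D"
      using shift[OF z0] zero by simp
    \<comment> \<open>At the reflected point the second summand of \<open>shift\<close> contains
      C(z) = 0 and disappears.\<close>
    have "?P (1 / cnj z) = 1 / cnj z * poly (monic_poly (n - 1) c) (1 / cnj z)"
      using shift[of "1 / cnj z"] zero z0 by simp
    moreover have "z ^ n = z * z ^ (n - 1)" using n by (cases n) auto
    ultimately have "z ^ n * cnj (?P (1 / cnj z)) = ?D"
      using z0 by simp
    then have "cmod ?D \<le> cmod (?P z)"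
      using Gamma_poly_reflect_le[OF x, of z] z by simp
    also have "\<dots> = cmod p * cmod ?D"
      unfolding P by (simp add: norm_mult norm_power)
    finally have "cmod ?D = 0"
      using p mult_strict_right_mono[of "cmod p" 1 "cmod ?D"] by fastforce
    then have "?P z = 0" using P by simp
    then show False using x z by (auto simp: Gamma_poly_iff)
  qed
qed

section \<open>Gauss-Lucas and points with unimodular last coordinate\<close>

lemma smult_sum_right: "smult c (\<Sum>i\<in>A. f i) = (\<Sum>i\<in>A. smult c (f i))"
  by (induction A rule: infinite_finite_induct) (simp_all add: smult_add_right)

text \<open>Differentiation brings down the exponent \<open>n - i\<close>; dividing by
  \<open>n\<close> makes the result monic again. Its coordinates are those of
  \<open>R\<close>.\<close>

lemma pderiv_monic_poly:
  assumes n: "n \<ge> 1"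
  shows "pderiv (monic_poly n x)
    = smult (of_nat n) (monic_poly (n - 1) (\<lambda>i\<in>{1..n - 1}. of_nat (n - i) / of_nat n * x i))"
proof -
  obtain m where m: "n = Suc m" using n by (cases n) auto
  have "pderiv (monic_poly n x)
      = (\<Sum>i\<le>m. monom (of_nat (n - i) * ((-1) ^ i * (if i = 0 then 1 else x i))) (n - i - 1))"
    unfolding monic_poly_def higher_pderiv_sum[of 1, simplified] pderiv_monom by (simp add: m)
  also have "\<dots> = (\<Sum>i\<le>m. smult (of_nat n) (monom ((-1) ^ i *
      (if i = 0 then 1 else (\<lambda>i\<in>{1..n - 1}. of_nat (n - i) / of_nat n * x i) i)) (m - i)))"
    using n m by (intro sum.cong) (auto simp: smult_monom simp del: of_nat_Suc)
  also have "\<dots> = smult (of_nat n) (\<Sum>i\<le>m. monom ((-1) ^ i *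
      (if i = 0 then 1 else (\<lambda>i\<in>{1..n - 1}. of_nat (n - i) / of_nat n * x i) i)) (m - i))"
    by (rule smult_sum_right[symmetric])
  finally show ?thesis
    by (simp only: monic_poly_def m diff_Suc_1)
qed

text \<open>Gauss--Lucas: outside the disc the logarithmic derivative times \<open>z\<close> has positive real part.\<close>

lemma derivative_in_Gamma_poly:
  assumes n: "n \<ge> 1" and x: "x \<in> Gamma_poly n"
  shows "(\<lambda>i\<in>{1..n - 1}. of_nat (n - i) / of_nat n * x i) \<in> Gamma_poly (n - 1)"
    (is "?R \<in> _")
  unfolding Gamma_poly_iff
proof (intro conjI allI impI)
  show "?R \<in> cspace (n - 1)" by (simp add: cspace_def)
  fix z assume "poly (monic_poly (n - 1) ?R) z = 0"
  then have zero: "poly (pderiv (monic_poly n x)) z = 0"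
    by (simp only: pderiv_monic_poly[OF n] poly_smult mult_zero_right)
  show "cmod z \<le> 1"
  proof (rule ccontr)
    assume "\<not> cmod z \<le> 1"
    then have z: "cmod z > 1" by simp
    obtain w where w: "\<forall>j\<in>{1..n}. cmod (w j) \<le> 1"
      "\<forall>z. poly (monic_poly n x) z = (\<Prod>j\<in>{1..n}. z - w j)"
      using Gamma_poly_roots[OF x] by blast
    have ne: "z - w j \<noteq> 0" if "j \<in> {1..n}" for j
      using w(1) that z by force
    have "(poly (monic_poly n x) has_field_derivative poly (pderiv (monic_poly n x)) z) (at z)"
      by (rule poly_DERIV)
    moreover have "poly (monic_poly n x) = (\<lambda>z. \<Prod>j\<in>{1..n}. z - w j)"
      using w(2) by blast
    moreover have "((\<lambda>z. \<Prod>j\<in>{1..n}. z - w j) has_field_derivative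
        (\<Prod>j\<in>{1..n}. z - w j) * (\<Sum>j\<in>{1..n}. 1 / (z - w j))) (at z)"
      using ne by (intro has_field_derivative_prod') (auto intro!: derivative_eq_intros)
    ultimately have "(\<Prod>j\<in>{1..n}. z - w j) * (\<Sum>j\<in>{1..n}. 1 / (z - w j)) = 0"
      using DERIV_unique zero by metis
    then have "(\<Sum>j\<in>{1..n}. 1 / (z - w j)) = 0"
      using ne by simp
    then have "0 = Re (z * (\<Sum>j\<in>{1..n}. 1 / (z - w j)))" by simp
    also have "\<dots> = (\<Sum>j\<in>{1..n}. Re (z / (z - w j)))"
      by (simp add: sum_distrib_left)
    also have "\<dots> > 0"
    proof (rule sum_pos)
      fix j assume j: "j \<in> {1..n}"
      \<comment> \<open>The sign of each term is that of \<open>Re (z * cnj (z - w j))\<close>, that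
        is of |z|^2 - Re (z * cnj (w j)), which is positive as |w j| \<le> 1 < |z|.\<close>
      have "Re (w j * cnj z) \<le> cmod (w j) * cmod z"
        using complex_Re_le_cmod[of "w j * cnj z"] by (simp add: norm_mult)
      also have "\<dots> \<le> 1 * cmod z"
        using w(1) j by (intro mult_right_mono) auto
      also have "\<dots> < (cmod z)\<^sup>2"
        using z by (simp add: power2_eq_square mult_less_cancel_right1)
      also have "\<dots> = Re (z * cnj z)"
        by (simp flip: complex_norm_square)
      finally have "Re (z * cnj (z - w j)) > 0"
        by (simp add: algebra_simps)
      then have "Re (z * cnj (z - w j)) / (cmod (z - w j))\<^sup>2 > 0"
        using ne[OF j] by (intro divide_pos_pos) auto
      then show "Re (z / (z - w j)) > 0"
        by (simp add: complex_div_cnj[of z])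
    qed (use n in auto)
    finally show False by simp
  qed
qed

text \<open>All zeros are unimodular, so conjugation inverts them. The conjugate of the product over
  a subset, times the product of all zeros, is therefore the product over the complement.\<close>

lemma Gamma_poly_unimodular_symmetry:
  assumes n: "n \<ge> 1" and x: "x \<in> Gamma_poly n" and p: "cmod (x n) = 1" and i: "i \<in> {1..n - 1}"
  shows "x i = cnj (x (n - i)) * x n"
proof -
  obtain w where w: "\<forall>j\<in>{1..n}. cmod (w j) \<le> 1" "x = symmetrization n w"
    using Gamma_poly_roots[OF x] by blast
  have "S = {1..n}" if "S \<subseteq> {1..n}" "card S = n" for S
    using that card_subset_eq[of "{1..n}" S] by simp
  then have "{S. S \<subseteq> {1..n} \<and> card S = n} = {{1..n}}" by auto
  then have xn: "x n = (\<Prod>j\<in>{1..n}. w j)"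
    using n by (simp add: w(2) symmetrization_def)
  \<comment> \<open>The other factors of the product contribute at most 1, so none can compensate
    for a modulus below 1.\<close>
  have unit: "cmod (w j) = 1" if j: "j \<in> {1..n}" for j
  proof -
    have "1 = cmod (w j) * (\<Prod>k\<in>{1..n} - {j}. cmod (w k))"
      using p j unfolding xn prod_norm[symmetric] by (subst (asm) prod.remove[of _ j]) auto
    also have "\<dots> \<le> cmod (w j) * 1"
      using w(1) by (intro mult_left_mono prod_le_1) auto
    finally show ?thesis using w(1) j by force
  qed
  have "cnj (x (n - i)) * x n
      = (\<Sum>S | S \<subseteq> {1..n} \<and> card S = n - i. (\<Prod>j\<in>S. cnj (w j)) * (\<Prod>j\<in>{1..n}. w j))"
    unfolding xn using i n by (auto simp: w(2) symmetrization_def sum_distrib_right)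
  also have "\<dots> = (\<Sum>S | S \<subseteq> {1..n} \<and> card S = i. \<Prod>j\<in>S. w j)"
  proof (rule sum.reindex_bij_witness[of _ "\<lambda>S. {1..n} - S" "\<lambda>S. {1..n} - S"])
    fix S assume S: "S \<in> {S. S \<subseteq> {1..n} \<and> card S = n - i}"
    then have "(\<Prod>j\<in>{1..n}. w j) = (\<Prod>j\<in>{1..n} - S. w j) * (\<Prod>j\<in>S. w j)"
      by (intro prod.subset_diff) auto
    moreover have "(\<Prod>j\<in>S. cnj (w j)) * (\<Prod>j\<in>S. w j) = 1"
      unfolding prod.distrib[symmetric]
    proof (rule prod.neutral, rule ballI)
      fix j assume "j \<in> S"
      then have "cmod (w j) = 1" using S unit by auto
      then show "cnj (w j) * w j = 1"
        using complex_norm_square[of "w j"] by (simp add: mult.commute)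
    qed
    ultimately show "(\<Prod>j\<in>{1..n} - S. w j) = (\<Prod>j\<in>S. cnj (w j)) * (\<Prod>j\<in>{1..n}. w j)"
      by (simp add: mult_ac)
  next
    fix S assume "S \<in> {S. S \<subseteq> {1..n} \<and> card S = n - i}"
    then show "{1..n} - S \<in> {S. S \<subseteq> {1..n} \<and> card S = i}"
      using i finite_subset[of S "{1..n}"] by (auto simp: card_Diff_subset)
  next
    fix S assume "S \<in> {S. S \<subseteq> {1..n} \<and> card S = i}"
    then show "{1..n} - S \<in> {S. S \<subseteq> {1..n} \<and> card S = n - i}"
      using finite_subset[of S "{1..n}"] by (auto simp: card_Diff_subset)
  qed auto
  also have "\<dots> = x i"
    using i by (auto simp: w(2) symmetrization_def)
  finally show ?thesis by simp
qed

section \<open>Scaling of the zeros\<close>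

text \<open>Multiplying every zero by \<open>a\<close> keeps it in the closed disc and multiplies
  each product of \<open>i\<close> zeros by \<open>a ^ i\<close>.\<close>

lemma scale_in_Gamma_poly:
  assumes x: "x \<in> Gamma_poly m" and a: "cmod a \<le> 1"
  shows "(\<lambda>i\<in>{1..m}. a ^ i * x i) \<in> Gamma_poly m"
proof -
  obtain w where w: "\<forall>j\<in>{1..m}. cmod (w j) \<le> 1" "x = symmetrization m w"
    using Gamma_poly_roots[OF x] by blast
  define v where "v = (\<lambda>j\<in>{1..m}. a * w j)"
  have "v \<in> {1..m} \<rightarrow>\<^sub>E cball 0 1"
    using w(1) a by (auto simp: v_def norm_mult mult_le_one)
  then have "symmetrization m v \<in> Gamma_poly m"
    unfolding Gamma_poly_def by (rule imageI)
  also have "symmetrization m v = (\<lambda>i\<in>{1..m}. a ^ i * x i)"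
  proof
    fix i
    have "(\<Prod>j\<in>S. v j) = a ^ i * (\<Prod>j\<in>S. w j)" if "S \<subseteq> {1..m} \<and> card S = i" for S
    proof -
      have "(\<Prod>j\<in>S. v j) = (\<Prod>j\<in>S. a * w j)"
        using that by (intro prod.cong) (auto simp: v_def)
      then show ?thesis using that by (simp add: prod.distrib)
    qed
    then have "(\<Sum>S | S \<subseteq> {1..m} \<and> card S = i. \<Prod>j\<in>S. v j)
        = a ^ i * (\<Sum>S | S \<subseteq> {1..m} \<and> card S = i. \<Prod>j\<in>S. w j)"
      unfolding sum_distrib_left by (intro sum.cong) auto
    then show "symmetrization m v i = (\<lambda>i\<in>{1..m}. a ^ i * x i) i"
      by (simp add: w(2) symmetrization_def)
  qed
  finally show ?thesis .
qed

lemma scale_tuple_in_Gamma_poly: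
  assumes n: "n \<ge> 1" and x: "tuple n s p \<in> Gamma_poly n" and a: "cmod a \<le> 1"
  shows "tuple n (\<lambda>i. a ^ i * s i) (a ^ n * p) \<in> Gamma_poly n"
proof -
  have "tuple n (\<lambda>i. a ^ i * s i) (a ^ n * p) = (\<lambda>i\<in>{1..n}. a ^ i * tuple n s p i)"
    using n by (auto simp: tuple_def fun_eq_iff)
  then show ?thesis using scale_in_Gamma_poly[OF x a] by simp
qed

section \<open>Inequalities between paired coordinates\<close>

text \<open>Completing the squares absorbs the linear terms. In particular the value is real, so its
  sign is a comparison of two moduli.\<close>

lemma Phi_eq:
  "Phi n i s p = of_real ((cmod (of_nat (n choose i) - s i))\<^sup>2
    - (cmod (of_nat (n choose i) * p - s (n - i)))\<^sup>2)"
  unfolding Phi_def of_real_diff complex_norm_square of_real_1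
  by (simp add: algebra_simps power2_eq_square)

lemma Phi_nonneg_iff:
  "Phi n i s p \<ge> 0
    \<longleftrightarrow> cmod (of_nat (n choose i) * p - s (n - i)) \<le> cmod (of_nat (n choose i) - s i)"
  by (simp add: Phi_eq less_eq_complex_def power_mono_iff del: of_real_diff of_real_power)

text \<open>With \<open>a\<close> and \<open>b\<close> as defined in the proof, the two squared
  moduli differ by \<open>((cmod a)^2 - (cmod b)^2) * (1 - (cmod p)^2)\<close>. The bound |b| \<le>
  |a| is Pascal's rule combined with the coordinate bounds.\<close>

lemma Gamma_poly_swap_le:
  assumes c: "c \<in> Gamma_poly (n - 1)" and i: "i \<in> {1..n - 1}" and p: "cmod p \<le> 1"
  shows "cmod (of_nat (n choose i) * p - (c (n - i) + cnj (c i) * p))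
    \<le> cmod (of_nat (n choose i) - (c i + cnj (c (n - i)) * p))"
proof -
  define a where "a = of_nat (n choose i) - c i"
  define b where "b = c (n - i)"
  have ni: "n - i \<in> {1..n - 1}" using i by auto
  have sym: "n - 1 choose (n - i) = n - 1 choose (i - 1)"
    using i binomial_symmetric[of "i - 1" "n - 1"] by force
  have pascal: "n choose i = (n - 1 choose (i - 1)) + (n - 1 choose i)"
    using i by (intro choose_reduce_nat) auto
  have "cmod b \<le> real (n - 1 choose (i - 1))"
    using Gamma_poly_coord_bound[OF c ni] unfolding b_def sym .
  also have "\<dots> = real (n choose i) - real (n - 1 choose i)"
    by (simp add: pascal)
  also have "\<dots> \<le> cmod (of_nat (n choose i)) - cmod (c i)"
    using Gamma_poly_coord_bound[OF c i] by simp
  also have "\<dots> \<le> cmod a"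
    unfolding a_def by (rule norm_triangle_ineq2)
  finally have ba: "(cmod b)\<^sup>2 \<le> (cmod a)\<^sup>2"
    by (rule power_mono) simp
  have "complex_of_real ((cmod (a - cnj b * p))\<^sup>2 - (cmod (cnj a * p - b))\<^sup>2)
      = complex_of_real (((cmod a)\<^sup>2 - (cmod b)\<^sup>2) * (1 - (cmod p)\<^sup>2))"
    unfolding of_real_diff of_real_mult complex_norm_square of_real_1 by (simp add: algebra_simps)
  then have "(cmod (a - cnj b * p))\<^sup>2 - (cmod (cnj a * p - b))\<^sup>2
      = ((cmod a)\<^sup>2 - (cmod b)\<^sup>2) * (1 - (cmod p)\<^sup>2)"
    using of_real_eq_iff by blast
  also have "\<dots> \<ge> 0"
    using ba p by (intro mult_nonneg_nonneg) (auto simp: power_le_one)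
  finally have "cmod (cnj a * p - b) \<le> cmod (a - cnj b * p)"
    using power2_le_imp_le[of "cmod (cnj a * p - b)" "cmod (a - cnj b * p)"] by simp
  then show ?thesis by (simp add: a_def b_def algebra_simps)
qed

text \<open>After squaring, \<open>u\<close> enters only through the cross term
  \<open>2 * C * Re (u * d)\<close>; the rotation making \<open>u * d\<close> equal to |d| gives the
  strongest inequality.\<close>

lemma unimodular_scaled_le_imp:
  fixes a b p :: complex and C :: real
  assumes "\<And>u. cmod u = 1 \<Longrightarrow> cmod (of_real C * u * p - b) \<le> cmod (of_real C - u * a)"
  shows "2 * C * cmod (a - cnj b * p) \<le> C\<^sup>2 * (1 - (cmod p)\<^sup>2) + (cmod a)\<^sup>2 - (cmod b)\<^sup>2"
proof -
  define d where "d = a - cnj b * p"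
  obtain u where u: "cmod u = 1" "u * d = of_real (cmod d)"
  proof (cases "d = 0")
    case True
    then show ?thesis using that[of 1] by simp
  next
    case False
    then show ?thesis
      using that[of "of_real (cmod d) / d"] by (simp add: norm_divide)
  qed
  have "complex_of_real ((cmod (of_real C - u * a))\<^sup>2 - (cmod (of_real C * u * p - b))\<^sup>2)
      = of_real (C\<^sup>2) - of_real (C\<^sup>2) * (u * cnj u) * (p * cnj p) + (u * cnj u) * (a * cnj a)
        - b * cnj b - of_real C * (u * d + cnj (u * d))"
    unfolding of_real_diff complex_norm_square d_def by (simp add: algebra_simps power2_eq_square)
  also have "u * cnj u = 1"
    using u(1) complex_norm_square[of u] by simp
  also have "of_real (C\<^sup>2) - of_real (C\<^sup>2) * 1 * (p * cnj p) + 1 * (a * cnj a)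
        - b * cnj b - of_real C * (u * d + cnj (u * d))
      = complex_of_real (C\<^sup>2 * (1 - (cmod p)\<^sup>2) + (cmod a)\<^sup>2 - (cmod b)\<^sup>2 - 2 * C * cmod d)"
    unfolding u(2) by (simp add: complex_norm_square algebra_simps flip: of_real_power)
  finally have "(cmod (of_real C - u * a))\<^sup>2 - (cmod (of_real C * u * p - b))\<^sup>2
      = C\<^sup>2 * (1 - (cmod p)\<^sup>2) + (cmod a)\<^sup>2 - (cmod b)\<^sup>2 - 2 * C * cmod d"
    using of_real_eq_iff by blast
  moreover have "(cmod (of_real C * u * p - b))\<^sup>2 \<le> (cmod (of_real C - u * a))\<^sup>2"
    using assms[OF u(1)] by (rule power_mono) simp
  ultimately show ?thesis unfolding d_def by linarith
qed

text \<open>Lets the power \<open>\<alpha> ^ i\<close> of a point of the circle be any prescribed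
  rotation.\<close>

lemma unimodular_root:
  assumes "cmod u = 1" "i \<ge> 1"
  obtains v where "cmod v = 1" "v ^ i = u"
proof (rule that[of "cis (Arg u / of_nat i)"])
  have "u \<noteq> 0" using assms(1) by auto
  then have "cis (Arg u) = u" using assms(1) by (simp add: cis_Arg sgn_eq)
  then show "cis (Arg u / of_nat i) ^ i = u"
    using assms(2) by (simp add: Complex.DeMoivre)
qed simp

section \<open>Scalar tuples\<close>

lemma compact_Gamma_poly: "compact (Gamma_poly m)"
proof -
  \<comment> \<open>Outside 1 to \<open>m\<close> the factor is the singleton of
    \<open>undefined\<close>, which presents the extensional functions as a full product, compact by
    Tychonoff's theorem.\<close>
  let ?S = "\<lambda>j. if j \<in> {1..m} then cball 0 1 else {undefined :: complex}"
  have "compactin (product_topology (\<lambda>_. euclidean) UNIV) (\<Pi>\<^sub>E j\<in>UNIV. ?S j)"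
    unfolding compactin_PiE by (simp add: compactin_euclidean_iff)
  then have "compact (\<Pi>\<^sub>E j\<in>UNIV. ?S j)"
    by (simp add: euclidean_product_topology compactin_euclidean_iff)
  moreover have "(\<Pi>\<^sub>E j\<in>UNIV. ?S j) = {1..m} \<rightarrow>\<^sub>E cball 0 1"
    unfolding PiE_def Pi_def extensional_def by (auto split: if_splits)
  ultimately have "compact ({1..m} \<rightarrow>\<^sub>E cball (0 :: complex) 1)" by simp
  moreover have "continuous_on A (symmetrization m)" for A
  proof (rule continuous_on_coordinatewise_then_product)
    fix i
    have "continuous_on A (\<lambda>z. \<Sum>S | S \<subseteq> {1..m} \<and> card S = i. \<Prod>j\<in>S. z j)"
      by (intro continuous_on_sum continuous_on_prod
          continuous_on_subset[OF continuous_on_product_coordinates] subset_UNIV)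
    then show "continuous_on A (\<lambda>z. symmetrization m z i)"
      unfolding symmetrization_def restrict_def by (cases "i \<in> {1..m}") auto
  qed
  ultimately show ?thesis
    unfolding Gamma_poly_def by (intro compact_continuous_image)
qed

section \<open>Koszul complex and Taylor spectrum of a scalar tuple\<close>

lemma commuting_tuple_scalar_ops: "commuting_tuple n (scalar_ops x)"
  unfolding commuting_tuple_def bounded_clinear_def scalar_ops_def
  by (auto simp: bounded_linear_mult_right scaleC_complex_def fun_eq_iff)

text \<open>Contraction with one basis vector anticommutes with exterior multiplication by another:
  whichever of \<open>j\<close> and \<open>l\<close> is smaller, exactly one of the two counts
  changes, and it changes by one.\<close>

lemma koszul_sign_swap:
  fixes j l :: nat
  assumes "finite S" "l \<in> S" "j \<notin> S"
  shows "(-1) ^ card {i\<in>S. i < l} * (-1) ^ card {i\<in>S - {l}. i < j}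
    = - ((-1 :: real) ^ card {i\<in>S. i < j} * (-1) ^ card {i\<in>insert j S. i < l})"
proof (cases "j < l")
  case True
  then have "{i\<in>S - {l}. i < j} = {i\<in>S. i < j}" by auto
  moreover have "{i\<in>insert j S. i < l} = insert j {i\<in>S. i < l}" using True by auto
  ultimately show ?thesis using assms by simp
next
  case False
  then have lj: "l < j" using assms by (metis linorder_neqE_nat)
  then have "{i\<in>S. i < j} = insert l {i\<in>S - {l}. i < j}" using assms by auto
  moreover have "{i\<in>insert j S. i < l} = {i\<in>S. i < l}" using lj by auto
  ultimately show ?thesis using assms by simp
qed

text \<open>Contraction with \<open>e\<^sub>j\<close>, divided by \<open>a j\<close>, is a chain homotopy between
  zero and the identity.\<close>

lemma koszul_exact_scalar:
  assumes j: "j \<in> {1..n}" and a: "a j \<noteq> (0 :: complex)"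
  shows "koszul_exact n (\<lambda>i x. a i * x)"
  unfolding koszul_exact_def
proof (intro allI impI)
  fix k and f :: "nat set \<Rightarrow> complex"
  assume "k \<le> n"
  assume "(\<forall>S. f S \<noteq> 0 \<longrightarrow> S \<subseteq> {1..n} \<and> card S = k) \<and> (\<forall>S. koszul_diff n (\<lambda>i x. a i * x) f S = 0)"
  then have supp: "\<And>S. f S \<noteq> 0 \<Longrightarrow> S \<subseteq> {1..n} \<and> card S = k"
    and closed: "\<And>S. koszul_diff n (\<lambda>i x. a i * x) f S = 0" by auto
  define e where "e S l = (-1 :: real) ^ card {i\<in>S. i < l}" for S :: "nat set" and l :: nat
  have ee: "e S l * e S l = 1" for S l by (simp add: e_def flip: power_add)
  have diff: "koszul_diff n (\<lambda>i x. a i * x) h S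
      = (if S \<subseteq> {1..n} then \<Sum>l\<in>S. e S l *\<^sub>R (a l * h (S - {l})) else 0)" for h S
    by (simp add: koszul_diff_def e_def)
  define g where "g S = (if j \<in> S then 0 else e S j *\<^sub>R (f (insert j S) / a j))" for S
  have "g S \<noteq> 0 \<longrightarrow> S \<subseteq> {1..n} \<and> Suc (card S) = k" for S
  proof
    assume "g S \<noteq> 0"
    then have "j \<notin> S" "f (insert j S) \<noteq> 0" by (auto simp: g_def split: if_splits)
    with supp[of "insert j S"] show "S \<subseteq> {1..n} \<and> Suc (card S) = k"
      using finite_subset[of S "{1..n}"] by auto
  qed
  moreover have "koszul_diff n (\<lambda>i x. a i * x) g S = f S" for S
  proof (cases "S \<subseteq> {1..n}")
    case False
    then show ?thesis using supp[of S] by (auto simp: koszul_diff_def)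
  next
    case S: True
    then have fin: "finite S" using finite_subset by blast
    show ?thesis
    proof (cases "j \<in> S")
      \<comment> \<open>Since \<open>g\<close> vanishes on sets containing \<open>j\<close>, only
        the summand \<open>l = j\<close> survives.\<close>
      case True
      have "(\<Sum>l\<in>S. e S l *\<^sub>R (a l * g (S - {l}))) = e S j *\<^sub>R (a j * g (S - {j}))"
        using True fin by (subst sum.remove[of _ j]) (auto simp: g_def intro!: sum.neutral)
      also have "e (S - {j}) j = e S j"
        unfolding e_def by (rule arg_cong[where f = "\<lambda>A. (-1) ^ card A"]) auto
      then have "g (S - {j}) = e S j *\<^sub>R (f S / a j)"
        using True by (simp add: g_def insert_absorb)
      also have "e S j *\<^sub>R (a j * (e S j *\<^sub>R (f S / a j))) = f S"
        using a ee[of S j] by simp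
      finally show ?thesis using S by (simp add: diff)
    next
      case False
      \<comment> \<open>Closedness of \<open>f\<close> at \<open>insert j S\<close> expresses
        \<open>a j * f S\<close> by the remaining terms, which up to a common factor are those of
        the differential of \<open>g\<close> at \<open>S\<close>.\<close>
      let ?T = "insert j S"
      have T: "?T \<subseteq> {1..n}" using S j by simp
      have "(\<Sum>l\<in>?T. e ?T l *\<^sub>R (a l * f (?T - {l}))) = 0"
        using closed[of ?T] T by (simp add: diff)
      then have zero: "e ?T j *\<^sub>R (a j * f S) + (\<Sum>l\<in>S. e ?T l *\<^sub>R (a l * f (?T - {l}))) = 0"
        using False fin by simp
      have eT: "e ?T j = e S j"
        unfolding e_def by (rule arg_cong[where f = "\<lambda>A. (-1) ^ card A"]) auto
      have "(\<Sum>l\<in>S. e S l *\<^sub>R (a l * g (S - {l})))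
          = (\<Sum>l\<in>S. (- (e S j) / a j) * (e ?T l *\<^sub>R (a l * f (?T - {l}))))"
      proof (rule sum.cong)
        fix l assume l: "l \<in> S"
        have "insert j (S - {l}) = ?T - {l}" using l False by auto
        then have "e S l *\<^sub>R (a l * g (S - {l}))
            = (e S l * e (S - {l}) j) *\<^sub>R (a l * f (?T - {l}) / a j)"
          using False by (simp add: g_def)
        also have "e S l * e (S - {l}) j = - (e S j * e ?T l)"
          unfolding e_def using fin l False by (rule koszul_sign_swap)
        finally show "e S l *\<^sub>R (a l * g (S - {l}))
            = (- (e S j) / a j) * (e ?T l *\<^sub>R (a l * f (?T - {l})))"
          by (simp add: scaleR_conv_of_real)
      qed simp
      also have "\<dots> = (- (e S j) / a j) * (- (e S j *\<^sub>R (a j * f S)))"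
        using zero unfolding sum_distrib_left[symmetric] eT by (simp add: add_eq_0_iff)
      also have "\<dots> = of_real (e S j * e S j) * f S"
        using a by (simp add: scaleR_conv_of_real)
      finally show ?thesis using S ee[of S j] by (simp add: diff)
    qed
  qed
  ultimately show "\<exists>g. (\<forall>S. g S \<noteq> 0 \<longrightarrow> S \<subseteq> {1..n} \<and> Suc (card S) = k)
      \<and> koszul_diff n (\<lambda>i x. a i * x) g = f"
    by blast
qed

text \<open>Exactness fails in degree 0: the first differential is zero, hence not
  injective.\<close>

lemma not_koszul_exact_zero:
  assumes "\<And>i x. i \<in> {1..n} \<Longrightarrow> T i x = (0 :: complex)"
  shows "\<not> koszul_exact n T"
proof
  assume exact: "koszul_exact n T"
  define f where "f S = (if S = {} then 1 else 0 :: complex)" for S :: "nat set"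
  have zero: "koszul_diff n T h S = 0" for h S
    using assms unfolding koszul_diff_def by (auto intro!: sum.neutral)
  have "(\<forall>S. f S \<noteq> 0 \<longrightarrow> S \<subseteq> {1..n} \<and> card S = 0) \<and> (\<forall>S. koszul_diff n T f S = 0)"
    by (auto simp: zero f_def)
  then obtain g where "koszul_diff n T g = f"
    using exact[unfolded koszul_exact_def, rule_format, of 0 f] by auto
  then have "f {} = 0" using zero[of g "{}"] by simp
  then show False by (simp add: f_def)
qed

text \<open>All differences vanish at \<open>z = x\<close>. Any other point of
  \<open>cspace n\<close> differs from \<open>x\<close> in a coordinate between 1 and
  \<open>n\<close>, by extensionality, and this difference makes the complex contractible.\<close>

lemma taylor_spectrum_scalar_ops:
  assumes x: "x \<in> cspace n"
  shows "taylor_spectrum n (scalar_ops x) = {x}"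
proof -
  have op: "(\<lambda>i y. scalar_ops x i y - z i *\<^sub>C y) = (\<lambda>i y. (x i - z i) * y)" for z
    by (simp add: scalar_ops_def scaleC_complex_def fun_eq_iff algebra_simps)
  have "\<not> koszul_exact n (\<lambda>i y. (x i - x i) * y)"
    by (rule not_koszul_exact_zero) simp
  moreover have "koszul_exact n (\<lambda>i y. (x i - z i) * y)" if "z \<in> cspace n" "z \<noteq> x" for z
  proof -
    have "\<not> (\<forall>j\<in>{1..n}. z j = x j)"
      using that x PiE_ext[of z "{1..n}" "\<lambda>_. UNIV" x] unfolding cspace_def by metis
    then obtain j where "j \<in> {1..n}" "x j - z j \<noteq> 0" by auto
    then show ?thesis by (rule koszul_exact_scalar)
  qed
  ultimately show ?thesis
    using x unfolding taylor_spectrum_def op by blast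
qed

section \<open>Rational functions of a scalar tuple\<close>

lemma poly_op_scalar_ops: "poly_op n P (scalar_ops x) = (\<lambda>z. poly_eval n P x * z)"
proof
  fix z
  have pow: "(scalar_ops x i ^^ k) y = x i ^ k * y" for i k y
    by (induction k) (simp_all add: scalar_ops_def mult_ac)
  have "foldr (\<lambda>i g. (scalar_ops x i ^^ e i) \<circ> g) is id z = (\<Prod>i\<leftarrow>is. x i ^ e i) * z" for e "is"
    by (induction "is") (simp_all add: pow mult_ac)
  moreover have "(\<Prod>i\<leftarrow>[1..<Suc n]. x i ^ e i) = (\<Prod>i\<in>{1..n}. x i ^ e i)" for e
    by (simp only: prod.distinct_set_conv_list[OF distinct_upt, symmetric] set_upt
        atLeastLessThanSuc_atLeastAtMost)
  ultimately show "poly_op n P (scalar_ops x) z = poly_eval n P x * z"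
    by (simp add: poly_op_def poly_eval_def scaleC_complex_def sum_distrib_right mult.assoc)
qed

lemma rat_op_scalar_ops:
  assumes "poly_eval n (snd F) x \<noteq> 0"
  shows "rat_op n F (scalar_ops x) = (\<lambda>z. rat_eval n F x * z)"
proof -
  have "inv (\<lambda>z. poly_eval n (snd F) x * z) = (\<lambda>z. z / poly_eval n (snd F) x)"
    using assms by (intro inv_equality) auto
  then show ?thesis
    by (simp add: rat_op_def rat_eval_def poly_op_scalar_ops fun_eq_iff)
qed

text \<open>The spectrum \<open>{x}\<close> forces \<open>x\<close> into \<open>X\<close>.
  Conversely a matrix of rational functions acts as its value at \<open>x\<close>, whose norm is one
  of the terms of the supremum.\<close>

lemma complete_spectral_set_scalar_ops_iff:
  assumes x: "x \<in> cspace n" and X: "X \<subseteq> cspace n" "compact X"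
  shows "complete_spectral_set n X (scalar_ops x) \<longleftrightarrow> x \<in> X"
proof
  assume "complete_spectral_set n X (scalar_ops x)"
  then show "x \<in> X"
    using taylor_spectrum_scalar_ops[OF x] by (simp add: complete_spectral_set_def)
next
  assume xX: "x \<in> X"
  have "ereal (matrix_opnorm k (\<lambda>i j. rat_op n (F i j) (scalar_ops x)))
      \<le> (SUP \<xi>\<in>X. ereal (matrix_opnorm k (\<lambda>i j (z::complex). rat_eval n (F i j) \<xi> * z)))"
    if F: "\<forall>i<k. \<forall>j<k. F i j \<in> rat_on n X" for k F
  proof -
    have "rat_op n (F i j) (scalar_ops x) = (\<lambda>z. rat_eval n (F i j) x * z)"
      if "i < k" "j < k" for i j
      using F xX that by (intro rat_op_scalar_ops) (auto simp: rat_on_def)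
    then have "matrix_opnorm k (\<lambda>i j. rat_op n (F i j) (scalar_ops x))
        = matrix_opnorm k (\<lambda>i j (z::complex). rat_eval n (F i j) x * z)"
      unfolding matrix_opnorm_def by (intro SUP_cong L2_set_cong arg_cong[where f = norm] sum.cong) auto
    then show ?thesis using xX by (auto intro: SUP_upper2)
  qed
  then show "complete_spectral_set n X (scalar_ops x)"
    using X xX taylor_spectrum_scalar_ops[OF x] commuting_tuple_scalar_ops
    by (simp add: complete_spectral_set_def)
qed

section \<open>The characterizations\<close>

text \<open>The relation for \<open>i\<close> and the conjugate of that for \<open>n - i\<close>
  form a linear system with determinant 1 - |p|^2, and \<open>Q\<close> is Cramer's rule.\<close>

lemma quotient_decomposition:
  fixes n i :: nat
  assumes p: "cmod p \<noteq> 1" and i: "i \<in> {1..n - 1}"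
    and Q: "Q = (\<lambda>i\<in>{1..n - 1}. (s i - cnj (s (n - i)) * p) / of_real (1 - (cmod p)\<^sup>2))"
  shows "s i = Q i + cnj (Q (n - i)) * p"
proof -
  define d where "d = complex_of_real (1 - (cmod p)\<^sup>2)"
  have "(cmod p)\<^sup>2 \<noteq> 1"
    using p by (simp add: power2_eq_1_iff) (metis norm_ge_zero not_one_le_zero neg_0_le_iff_le)
  then have d0: "d \<noteq> 0" unfolding d_def of_real_eq_0_iff by simp
  have d: "d = 1 - p * cnj p" "cnj d = d"
    by (simp_all add: d_def complex_norm_square del: of_real_power)
  have "n - i \<in> {1..n - 1}" "n - (n - i) = i" using i by auto
  then have "Q i + cnj (Q (n - i)) * p
      = (s i - cnj (s (n - i)) * p) / d + (cnj (s (n - i)) - s i * cnj p) / d * p"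
    using i d(2) unfolding Q d_def[symmetric] by simp
  also have "\<dots> = s i * (1 - p * cnj p) / d"
    by (simp add: add_divide_distrib[symmetric] algebra_simps)
  also have "\<dots> = s i" using d0 d(1) by simp
  finally show ?thesis by simp
qed

text \<open>By the symmetry both summands are multiples of \<open>s i\<close>, with weights
  \<open>(n - i) / n\<close> and \<open>i / n\<close> adding up to 1.\<close>

lemma derivative_decomposition:
  assumes s: "s i = cnj (s (n - i)) * p" and i: "i \<in> {1..n - 1}"
    and R: "R = (\<lambda>i\<in>{1..n - 1}. of_nat (n - i) / of_nat n * s i)"
  shows "s i = R i + cnj (R (n - i)) * p"
proof -
  have n: "complex_of_nat n \<noteq> 0" using i by auto
  have ni: "n - i \<in> {1..n - 1}" "n - (n - i) = i" using i by auto
  have "R i + cnj (R (n - i)) * p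
      = of_nat (n - i) / of_nat n * s i + of_nat i / of_nat n * (cnj (s (n - i)) * p)"
    using i ni by (simp add: R)
  also have "\<dots> = (of_nat (n - i) + of_nat i) / of_nat n * s i"
    unfolding s[symmetric] by (simp add: add_divide_distrib distrib_right)
  also have "of_nat (n - i) + of_nat i = complex_of_nat n"
  proof -
    have "n - i + i = n" using i by auto
    then show ?thesis by (simp only: of_nat_add[symmetric])
  qed
  also have "of_nat n / of_nat n * s i = s i" using n by simp
  finally show ?thesis by simp
qed

lemma Gamma_poly_last_le:
  assumes "n \<ge> 1" "tuple n s p \<in> Gamma_poly n"
  shows "cmod p \<le> 1"
  using Gamma_poly_coord_bound[OF assms(2), of n] tuple_simps(2)[OF assms(1), of s p] assms(1)
  by simp

lemma Gamma_poly_tuple_symmetry: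
  assumes x: "tuple n s p \<in> Gamma_poly n" and p: "cmod p = 1" and i: "i \<in> {1..n - 1}"
  shows "s i = cnj (s (n - i)) * p"
proof -
  have n: "n \<ge> 1" and ni: "n - i \<in> {1..n - 1}" using i by auto
  show ?thesis
    using Gamma_poly_unimodular_symmetry[OF n x _ i] p
    by (simp only: tuple_simps(1)[OF n i] tuple_simps(1)[OF n ni] tuple_simps(2)[OF n])
qed

lemma derivative_tuple_in_Gamma_poly:
  assumes n: "n \<ge> 1" and x: "tuple n s p \<in> Gamma_poly n"
  shows "(\<lambda>i\<in>{1..n - 1}. of_nat (n - i) / of_nat n * s i) \<in> Gamma_poly (n - 1)"
proof -
  have "(\<lambda>i\<in>{1..n - 1}. of_nat (n - i) / of_nat n * s i)
      = (\<lambda>i\<in>{1..n - 1}. of_nat (n - i) / of_nat n * tuple n s p i)"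
    using tuple_simps(1)[OF n] by (intro restrict_ext) simp
  then show ?thesis using derivative_in_Gamma_poly[OF n x] by simp
qed

lemma quotient_tuple_in_Gamma_poly:
  assumes n: "n \<ge> 1" and x: "tuple n s p \<in> Gamma_poly n" and p: "cmod p \<noteq> 1"
  shows "(\<lambda>i\<in>{1..n - 1}. (s i - cnj (s (n - i)) * p) / of_real (1 - (cmod p)\<^sup>2))
    \<in> Gamma_poly (n - 1)" (is "?Q \<in> _")
proof (rule reflection_solution_in_Gamma_poly[OF n _ _ x])
  show "cmod p < 1" using Gamma_poly_last_le[OF n x] p by simp
  show "?Q \<in> cspace (n - 1)" by (simp add: cspace_def)
  show "s i = ?Q i + cnj (?Q (n - i)) * p" if "i \<in> {1..n - 1}" for i
    using p that refl by (rule quotient_decomposition)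
qed

text \<open>The witness is \<open>Q\<close> off the circle; for unimodular \<open>p\<close>, where
  the linear system is singular, it is \<open>R\<close>.\<close>

lemma Gamma_poly_decomposition:
  assumes n: "n \<ge> 1" and x: "tuple n s p \<in> Gamma_poly n"
  shows "\<exists>c\<in>Gamma_poly (n - 1). \<forall>i\<in>{1..n - 1}. s i = c i + cnj (c (n - i)) * p"
proof (cases "cmod p = 1")
  case True
  have "s i = (\<lambda>i\<in>{1..n - 1}. of_nat (n - i) / of_nat n * s i) i
      + cnj ((\<lambda>i\<in>{1..n - 1}. of_nat (n - i) / of_nat n * s i) (n - i)) * p"
    if "i \<in> {1..n - 1}" for i
    using Gamma_poly_tuple_symmetry[OF x True that] that refl by (rule derivative_decomposition)
  then show ?thesis using derivative_tuple_in_Gamma_poly[OF n x] by (intro bexI ballI)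
next
  case False
  have "s i = (\<lambda>i\<in>{1..n - 1}. (s i - cnj (s (n - i)) * p) / of_real (1 - (cmod p)\<^sup>2)) i
      + cnj ((\<lambda>i\<in>{1..n - 1}. (s i - cnj (s (n - i)) * p) / of_real (1 - (cmod p)\<^sup>2)) (n - i)) * p"
    if "i \<in> {1..n - 1}" for i
    using False that refl by (rule quotient_decomposition)
  then show ?thesis using quotient_tuple_in_Gamma_poly[OF n x False] by (intro bexI ballI)
qed

section \<open>From membership to the inequalities and back\<close>

text \<open>The scaled tuple is again a member, so its own decomposition can be fed into
  \<open>Gamma_poly_swap_le\<close>.\<close>

lemma Gamma_poly_scaled_le:
  assumes x: "tuple n s p \<in> Gamma_poly n" and a: "cmod a \<le> 1" and i: "i \<in> {1..n - 1}"
  shows "cmod (of_nat (n choose i) * a ^ n * p - a ^ (n - i) * s (n - i))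
    \<le> cmod (of_nat (n choose i) - a ^ i * s i)"
proof -
  have n: "n \<ge> 1" and ni: "n - i \<in> {1..n - 1}" "n - (n - i) = i" using i by auto
  have x': "tuple n (\<lambda>i. a ^ i * s i) (a ^ n * p) \<in> Gamma_poly n"
    using n x a by (rule scale_tuple_in_Gamma_poly)
  then obtain c where c: "c \<in> Gamma_poly (n - 1)"
    and eq: "\<forall>i\<in>{1..n - 1}. a ^ i * s i = c i + cnj (c (n - i)) * (a ^ n * p)"
    using Gamma_poly_decomposition[OF n x'] by blast
  show ?thesis
    using Gamma_poly_swap_le[OF c i Gamma_poly_last_le[OF n x']]
    unfolding eq[rule_format, OF i] eq[rule_format, OF ni(1)] ni(2) mult.assoc .
qed

lemma Phi_scaled_nonneg_iff:
  "Phi n i (\<lambda>j. a ^ j * s j) (a ^ n * p) \<ge> 0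
    \<longleftrightarrow> cmod (of_nat (n choose i) * a ^ n * p - a ^ (n - i) * s (n - i))
      \<le> cmod (of_nat (n choose i) - a ^ i * s i)"
  by (simp add: Phi_nonneg_iff mult.assoc)

text \<open>Adding the bounds of \<open>unimodular_scaled_le_imp\<close> for \<open>i\<close> and
  \<open>n - i\<close> cancels the differences of squared moduli of coordinates; then
  \<open>2 * C\<close> is divided out.\<close>

lemma scaled_le_imp_sum_le:
  assumes le: "\<And>a i. cmod a \<le> 1 \<Longrightarrow> i \<in> {1..n - 1} \<Longrightarrow>
      cmod (of_nat (n choose i) * a ^ n * p - a ^ (n - i) * s (n - i))
        \<le> cmod (of_nat (n choose i) - a ^ i * s i)"
    and i: "i \<in> {1..n - 1}"
  shows "cmod (s i - cnj (s (n - i)) * p) + cmod (s (n - i) - cnj (s i) * p)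
    \<le> real (n choose i) * (1 - (cmod p)\<^sup>2)"
proof -
  define C where "C = real (n choose i)"
  have C: "C > 0" using i by (auto simp: C_def)
  have *: "2 * real (n choose k) * cmod (s k - cnj (s (n - k)) * p)
      \<le> (real (n choose k))\<^sup>2 * (1 - (cmod p)\<^sup>2) + (cmod (s k))\<^sup>2 - (cmod (s (n - k)))\<^sup>2"
    if k: "k \<in> {1..n - 1}" for k
  proof (rule unimodular_scaled_le_imp)
    fix u :: complex assume "cmod u = 1"
    moreover have "k \<ge> 1" using k by simp
    ultimately obtain v where v: "cmod v = 1" "v ^ k = u" by (rule unimodular_root)
    \<comment> \<open>With \<open>v ^ k = u\<close> the left side of \<open>le\<close> has the
      factor \<open>v ^ (n - k)\<close>, which is unimodular and drops out of the modulus.\<close>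
    have "n - k + k = n" using k by auto
    then have "v ^ n = v ^ (n - k) * u"
      using power_add[of v "n - k" k] v(2) by simp
    then have "of_nat (n choose k) * v ^ n * p - v ^ (n - k) * s (n - k)
        = v ^ (n - k) * (of_real (real (n choose k)) * u * p - s (n - k))"
      by (simp add: algebra_simps)
    then show "cmod (of_real (real (n choose k)) * u * p - s (n - k))
        \<le> cmod (of_real (real (n choose k)) - u * s k)"
      using le[of v k] k v by (simp add: norm_mult norm_power)
  qed
  have ni: "n - i \<in> {1..n - 1}" "n - (n - i) = i" using i by auto
  have "n choose (n - i) = n choose i"
    using i binomial_symmetric[of i n] by force
  then have "2 * C * (cmod (s i - cnj (s (n - i)) * p) + cmod (s (n - i) - cnj (s i) * p))
      \<le> 2 * C * (C * (1 - (cmod p)\<^sup>2))"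
    using *[OF i] *[OF ni(1)] unfolding ni(2) C_def[symmetric]
    by (simp add: C_def algebra_simps power2_eq_square)
  then show ?thesis using C by (simp add: C_def)
qed

text \<open>The inequality for \<open>i = 1\<close> bounds |p| by 1. If |p| = 1 its right side
  vanishes for every \<open>i\<close>, which forces the symmetry that \<open>R\<close>
  requires.\<close>

lemma sum_le_imp_in_Gamma_poly:
  assumes n: "n \<ge> 2"
    and Q: "Q = (\<lambda>i\<in>{1..n - 1}. (s i - cnj (s (n - i)) * p) / of_real (1 - (cmod p)\<^sup>2))"
    and R: "R = (\<lambda>i\<in>{1..n - 1}. of_nat (n - i) / of_nat n * s i)"
    and le: "\<And>i. i \<in> {1..n - 1} \<Longrightarrow>
      cmod (s i - cnj (s (n - i)) * p) + cmod (s (n - i) - cnj (s i) * p)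
        \<le> real (n choose i) * (1 - (cmod p)\<^sup>2)"
    and QR: "cmod p = 1 \<and> R \<in> Gamma_poly (n - 1) \<or> cmod p \<noteq> 1 \<and> Q \<in> Gamma_poly (n - 1)"
  shows "tuple n s p \<in> Gamma_poly n"
proof -
  have n1: "n \<ge> 1" using n by simp
  have "0 \<le> real (n choose 1) * (1 - (cmod p)\<^sup>2)"
    using n by (intro order_trans[OF _ le[of 1]]) auto
  then have "(cmod p)\<^sup>2 \<le> 1\<^sup>2"
    using n by (simp add: zero_le_mult_iff)
  then have p: "cmod p \<le> 1" by (rule power2_le_imp_le) simp
  show ?thesis
  proof (cases "cmod p = 1")
    case True
    have "s i = cnj (s (n - i)) * p" if "i \<in> {1..n - 1}" for i
    proof -
      have "cmod (s i - cnj (s (n - i)) * p) \<le> 0"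
        using le[OF that] norm_ge_zero[of "s (n - i) - cnj (s i) * p"]
        unfolding True by (simp del: norm_le_zero_iff norm_ge_zero)
      then show ?thesis by simp
    qed
    then have "s i = R i + cnj (R (n - i)) * p" if "i \<in> {1..n - 1}" for i
      using that R by (intro derivative_decomposition)
    then show ?thesis using tuple_in_Gamma_polyI[OF n1 p] QR True by blast
  next
    case False
    then have "s i = Q i + cnj (Q (n - i)) * p" if "i \<in> {1..n - 1}" for i
      using that Q by (rule quotient_decomposition)
    then show ?thesis using tuple_in_Gamma_polyI[OF n1 p] QR False by blast
  qed
qed

theorem theorem3p3:
  fixes n :: nat and s :: "nat \<Rightarrow> complex" and p :: complex
  assumes "n \<ge> 2"
  shows
    "let Q = (\<lambda>i\<in>{1..n - 1}. (s i - cnj (s (n - i)) * p) / of_real (1 - (cmod p)\<^sup>2));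
         R = (\<lambda>i\<in>{1..n - 1}. of_nat (n - i) / of_nat n * s i);
         QR = ((cmod p = 1 \<and> R \<in> Gamma_poly (n - 1)) \<or> (cmod p \<noteq> 1 \<and> Q \<in> Gamma_poly (n - 1)));
         C1 = (tuple n s p \<in> Gamma_poly n);
         C2 = complete_spectral_set n (Gamma_poly n) (scalar_ops (tuple n s p));
         C3 = (\<forall>\<omega>\<in>sphere 0 1. tuple n (\<lambda>i. \<omega> ^ i * s i) (\<omega> ^ n * p) \<in> Gamma_poly n);
         C4 = ((\<forall>\<alpha>\<in>cball 0 1. \<forall>i\<in>{1..n - 1}.
                  Phi n i (\<lambda>j. \<alpha> ^ j * s j) (\<alpha> ^ n * p) \<ge> 0) \<and> QR);
         C5 = ((\<forall>\<alpha>\<in>cball 0 1. \<forall>i\<in>{1..n - 1}.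
                  cmod (of_nat (n choose i) * \<alpha> ^ n * p - \<alpha> ^ (n - i) * s (n - i))
                    \<le> cmod (of_nat (n choose i) - \<alpha> ^ i * s i)) \<and> QR);
         C6 = ((\<forall>i\<in>{1..n - 1}.
                  cmod (s i - cnj (s (n - i)) * p) + cmod (s (n - i) - cnj (s i) * p)
                    \<le> real (n choose i) * (1 - (cmod p)\<^sup>2)) \<and> QR);
         C7 = (cmod p \<le> 1 \<and> (\<exists>c\<in>Gamma_poly (n - 1). \<forall>i\<in>{1..n - 1}.
                  s i = c i + cnj (c (n - i)) * p))
     in (C1 \<longleftrightarrow> C2) \<and> (C1 \<longleftrightarrow> C3) \<and> (C1 \<longleftrightarrow> C4) \<and> (C1 \<longleftrightarrow> C5) \<and> (C1 \<longleftrightarrow> C6) \<and> (C1 \<longleftrightarrow> C7)"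
proof -
  have n: "n \<ge> 1" using assms by simp
  let ?Q = "\<lambda>i\<in>{1..n - 1}. (s i - cnj (s (n - i)) * p) / of_real (1 - (cmod p)\<^sup>2)"
  let ?R = "\<lambda>i\<in>{1..n - 1}. of_nat (n - i) / of_nat n * s i"
  define QR where "QR \<longleftrightarrow> cmod p = 1 \<and> ?R \<in> Gamma_poly (n - 1)
    \<or> cmod p \<noteq> 1 \<and> ?Q \<in> Gamma_poly (n - 1)"
  define C1 where "C1 \<longleftrightarrow> tuple n s p \<in> Gamma_poly n"
  define C5 where "C5 \<longleftrightarrow> (\<forall>\<alpha>\<in>cball 0 1. \<forall>i\<in>{1..n - 1}.
    cmod (of_nat (n choose i) * \<alpha> ^ n * p - \<alpha> ^ (n - i) * s (n - i))
      \<le> cmod (of_nat (n choose i) - \<alpha> ^ i * s i))"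
  define C6 where "C6 \<longleftrightarrow> (\<forall>i\<in>{1..n - 1}.
    cmod (s i - cnj (s (n - i)) * p) + cmod (s (n - i) - cnj (s i) * p)
      \<le> real (n choose i) * (1 - (cmod p)\<^sup>2))"
  have QR: QR if C1
    using derivative_tuple_in_Gamma_poly[OF n] quotient_tuple_in_Gamma_poly[OF n] that
    unfolding QR_def C1_def by blast
  have 2: "C1 \<longleftrightarrow> complete_spectral_set n (Gamma_poly n) (scalar_ops (tuple n s p))"
    unfolding C1_def using tuple_simps(3)[OF n] compact_Gamma_poly
    by (subst complete_spectral_set_scalar_ops_iff) (auto simp: Gamma_poly_iff)
  have 3: "C1 \<longleftrightarrow> (\<forall>\<omega>\<in>sphere 0 1. tuple n (\<lambda>i. \<omega> ^ i * s i) (\<omega> ^ n * p) \<in> Gamma_poly n)"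
  proof
    assume C1
    then show "\<forall>\<omega>\<in>sphere 0 1. tuple n (\<lambda>i. \<omega> ^ i * s i) (\<omega> ^ n * p) \<in> Gamma_poly n"
      using scale_tuple_in_Gamma_poly[OF n] by (auto simp: C1_def)
  next
    assume "\<forall>\<omega>\<in>sphere 0 1. tuple n (\<lambda>i. \<omega> ^ i * s i) (\<omega> ^ n * p) \<in> Gamma_poly n"
    from bspec[OF this, of 1] show C1 by (simp add: C1_def)
  qed
  have 15: C5 if C1
    using that Gamma_poly_scaled_le unfolding C1_def C5_def by simp
  have 56: C6 if C5
    unfolding C6_def
  proof
    fix i assume "i \<in> {1..n - 1}"
    then show "cmod (s i - cnj (s (n - i)) * p) + cmod (s (n - i) - cnj (s i) * p)
        \<le> real (n choose i) * (1 - (cmod p)\<^sup>2)"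
      using that by (intro scaled_le_imp_sum_le) (auto simp: C5_def)
  qed
  have 61: C1 if C6 QR
    unfolding C1_def
    by (rule sum_le_imp_in_Gamma_poly[OF assms refl refl _ that(2)[unfolded QR_def]])
      (use that(1) in \<open>simp add: C6_def\<close>)
  have 7: "C1 \<longleftrightarrow> cmod p \<le> 1 \<and> (\<exists>c\<in>Gamma_poly (n - 1). \<forall>i\<in>{1..n - 1}.
      s i = c i + cnj (c (n - i)) * p)"
    unfolding C1_def
    using tuple_in_Gamma_polyI[OF n] Gamma_poly_decomposition[OF n] Gamma_poly_last_le[OF n]
    by blast
  \<comment> \<open>C1 gives C5, C5 gives C6, and C6 returns to C1 together with \<open>QR\<close>,
    which C1 supplies.\<close>
  have 5: "C1 \<longleftrightarrow> C5 \<and> QR" and 6: "C1 \<longleftrightarrow> C6 \<and> QR"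
    using QR 15 56 61 by blast+
  show ?thesis
    \<comment> \<open>Rewriting turns the condition on \<open>Phi\<close> into the one on moduli,
      hence \<open>5\<close> serves twice.\<close>
    unfolding Let_def Phi_scaled_nonneg_iff
    using 2 3 5 5 6 7 unfolding C1_def C5_def C6_def QR_def by (intro conjI)
qed

end
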